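(* For all $n\ge1$ and $k,\ell,m,j\ge 0$, let $$d_n(k,\ell,m,j)=\bigl|\{\pi\in\mathcal{I}_n(312,4321) : \operatorname{fp}(\pi)=m,\ \operatorname{exc}(\pi)=\ell,\ \operatorname{cyc}(\pi)=k,\ \operatorname{inv}(\pi)=j\}\bigr|,$$ and let $$D(t,u,x,y,z)=\sum_{n\ge1}\ \sum_{k,\ell,m,j\ge 0} d_n(k,\ell,m,j)\,t^ku^mx^\ell y^jz^n,$$ a formal power series in $z$ with coefficients in $\mathbb{Z}[t,u,x,y]$. Then $$D(t,u,x,y,z)=\frac{tuz+txyz^2+t^2uxy^3z^3}{1-utz-txyz^2-t^2uxy^3z^3}.$$
   Context: $\mathcal{S}_n$ is the set of permutations of $[n]=\{1,\dots,n\}$; $\pi\in\mathcal{S}_n$ is written in one-line notation as $\pi=\pi_1\pi_2\cdots\pi_n$ with $\pi_i=\pi(i)$. A permutation $\pi\in\mathcal{S}_n$ contains a pattern $\sigma\in\mathcal{S}_r$ if there are indices $i_1<\dots<i_r$ such that $\pi_{i_1}\cdots\pi_{i_r}$ is in the same relative order as $\sigma$; otherwise $\pi$ avoids $\sigma$. $\mathcal{I}_n(312,4321)$ is the set of involutions $\pi\in\mathcal{S}_n$ (i.e. $\pi^{-1}=\pi$, the identity included) avoiding both patterns $312$ and $4321$. $\operatorname{cyc}(\pi)$ is the number of cycles in the disjoint cycle decomposition of $\pi$ (fixed points counted as cycles); $\operatorname{fp}(\pi)$ is the number of $i$ with $\pi_i=i$; $\operatorname{exc}(\pi)$ is the number of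 $j$ with $\pi_j>j$; $\operatorname{inv}(\pi)$ is the number of pairs $i<j$ with $\pi_i>\pi_j$. *)

theory Defs
  imports
    "HOL-Combinatorics.Permutations"
    "HOL-Combinatorics.Orbits"
    "HOL-Computational_Algebra.Polynomial"
    "HOL-Computational_Algebra.Formal_Power_Series"
    "HOL-Library.Groups_Big_Fun"
begin

(* The pattern is a list giving its one-line notation; the chosen positions are
   s 0 < ... < s (r - 1), where r is the length of the list. *)
definition contains_pattern :: "nat \<Rightarrow> (nat \<Rightarrow> nat) \<Rightarrow> nat list \<Rightarrow> bool" where
  "contains_pattern n p ws \<longleftrightarrow>
     (\<exists>s :: nat \<Rightarrow> nat.
        strict_mono_on {..<length ws} s \<and>
        s ` {..<length ws} \<subseteq> {1..n} \<and>
        (\<forall>a<length ws. \<forall>b<length ws. p (s a) < p (s b) \<longleftrightarrow> ws ! a < ws ! b))"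

definition avoids_pattern :: "nat \<Rightarrow> (nat \<Rightarrow> nat) \<Rightarrow> nat list \<Rightarrow> bool" where
  "avoids_pattern n p ws \<longleftrightarrow> \<not> contains_pattern n p ws"

definition invols_312_4321 :: "nat \<Rightarrow> (nat \<Rightarrow> nat) set" where
  "invols_312_4321 n =
     {p. p permutes {1..n} \<and> inv p = p \<and>
         avoids_pattern n p [3, 1, 2] \<and> avoids_pattern n p [4, 3, 2, 1]}"

definition fp :: "nat \<Rightarrow> (nat \<Rightarrow> nat) \<Rightarrow> nat" where
  "fp n p = card {i \<in> {1..n}. p i = i}"

definition exc :: "nat \<Rightarrow> (nat \<Rightarrow> nat) \<Rightarrow> nat" where
  "exc n p = card {j \<in> {1..n}. p j > j}"

(* The cycles of a permutation are its orbits; a fixed point i has orbit {i}. *)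
definition cyc :: "nat \<Rightarrow> (nat \<Rightarrow> nat) \<Rightarrow> nat" where
  "cyc n p = card (orbit p ` {1..n})"

definition inversion_count :: "nat \<Rightarrow> (nat \<Rightarrow> nat) \<Rightarrow> nat" where
  "inversion_count n p = card {(i, j). i \<in> {1..n} \<and> j \<in> {1..n} \<and> i < j \<and> p i > p j}"

definition d :: "nat \<Rightarrow> nat \<Rightarrow> nat \<Rightarrow> nat \<Rightarrow> nat \<Rightarrow> nat" where
  "d n k l m j =
     card {p \<in> invols_312_4321 n.
             fp n p = m \<and> exc n p = l \<and> cyc n p = k \<and> inversion_count n p = j}"

(* The polynomial ring Z[t,u,x,y], built as Z[y][x][u][t]. *)
type_synonym coeff_ring = "int poly poly poly poly"

definition var_t :: coeff_ring where "var_t = [:0, 1:]"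
definition var_u :: coeff_ring where "var_u = [:[:0, 1:]:]"
definition var_x :: coeff_ring where "var_x = [:[:[:0, 1:]:]:]"
definition var_y :: coeff_ring where "var_y = [:[:[:[:0, 1:]:]:]:]"

(* Sum_any is the sum over all of the index type; its value would be 0 by convention
   for infinite support, which d_finite_support below excludes. *)
definition D :: "coeff_ring fps" where
  "D = Abs_fps (\<lambda>n. if n \<ge> 1 then
         Sum_any (\<lambda>(k, l, m, j).
           of_nat (d n k l m j) * var_t ^ k * var_u ^ m * var_x ^ l * var_y ^ j)
       else 0)"

(* Coefficients do not form a field here, so the library's division on fps is not available.
   For a denominator with constant coefficient 1, a unit, this is the quotient. *)
definition fps_quot :: "'a::comm_ring_1 fps \<Rightarrow> 'a fps \<Rightarrow> 'a fps" where
  "fps_quot f g = f * fps_right_inverse g 1"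

lemma fps_quot_mult:
  assumes "fps_nth g 0 = 1"
  shows "fps_quot f g * g = f"
proof -
  have "g * fps_right_inverse g 1 = 1"
    by (rule fps_right_inverse) (simp add: assms)
  then show ?thesis
    by (metis fps_quot_def mult.assoc mult.commute mult.right_neutral)
qed

lemma d_finite_support: "finite {(k, l, m, j). d n k l m j \<noteq> 0}"
proof (rule finite_subset)
  show "{(k, l, m, j). d n k l m j \<noteq> 0} \<subseteq>
        (\<lambda>p. (cyc n p, exc n p, fp n p, inversion_count n p)) ` {p. p permutes {1..n}}"
  proof clarify
    fix k l m j assume "d n k l m j > 0"
    then have "{p \<in> invols_312_4321 n.
        fp n p = m \<and> exc n p = l \<and> cyc n p = k \<and> inversion_count n p = j} \<noteq> {}"
      unfolding d_def by (metis card.empty less_irrefl)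
    then show "(k, l, m, j) \<in>
        (\<lambda>p. (cyc n p, exc n p, fp n p, inversion_count n p)) ` {p. p permutes {1..n}}"
      by (force simp: invols_312_4321_def)
  qed
qed (simp add: finite_permutations)

end

theory Submission
  imports Defs
begin

text \<open>
  An involution avoiding 312 also avoids the inverse pattern 231, so it is layered: a direct sum of
  decreasing blocks. Avoiding 4321 bounds the block sizes by 3. Blocks of size 1, 2 and 3 contribute
  the weights \<open>tu\<close>, \<open>txy\<close> and \<open>t\<^sup>2uxy\<^sup>3\<close>, and splitting off the last block yields the linear
  recurrence \<open>E = 1 + P E\<close> for \<open>E = 1 + D\<close>, where \<open>P\<close> is the numerator of the claimed quotient.
\<close>

section \<open>Patterns and membership as inequalities between positions and values\<close>

lemma contains_312_iff:
  "contains_pattern n p [3, 1, 2] \<longleftrightarrow>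
     (\<exists>a b c. 1 \<le> a \<and> a < b \<and> b < c \<and> c \<le> n \<and> p b < p c \<and> p c < p a)"
proof
  assume "contains_pattern n p [3, 1, 2]"
  then obtain s :: "nat \<Rightarrow> nat" where mono: "strict_mono_on {..<3} s" and ran: "s ` {..<3} \<subseteq> {1..n}"
    and ord: "\<And>a b. a < 3 \<Longrightarrow> b < 3 \<Longrightarrow> p (s a) < p (s b) \<longleftrightarrow> [3, 1, 2::nat] ! a < [3, 1, 2] ! b"
    unfolding contains_pattern_def by (auto simp: numeral_eq_Suc)
  have "s 0 < s 1" "s 1 < s 2" using mono by (auto simp: strict_mono_on_def)
  moreover have "1 \<le> s 0" "s 2 \<le> n" using ran by (auto simp: image_subset_iff)
  moreover have "p (s 1) < p (s 2)" "p (s 2) < p (s 0)" by (simp_all add: ord)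
  ultimately show "\<exists>a b c. 1 \<le> a \<and> a < b \<and> b < c \<and> c \<le> n \<and> p b < p c \<and> p c < p a" by blast
next
  assume "\<exists>a b c. 1 \<le> a \<and> a < b \<and> b < c \<and> c \<le> n \<and> p b < p c \<and> p c < p a"
  then obtain a b c where "1 \<le> a" "a < b" "b < c" "c \<le> n" "p b < p c" "p c < p a" by blast
  then show "contains_pattern n p [3, 1, 2]"
    unfolding contains_pattern_def
    by (intro exI[of _ "nth [a, b, c]"])
      (auto simp: strict_mono_on_def lessThan_Suc All_less_Suc numeral_eq_Suc)
qed

lemma contains_4321_iff:
  "contains_pattern n p [4, 3, 2, 1] \<longleftrightarrow>
     (\<exists>a b c e. 1 \<le> a \<and> a < b \<and> b < c \<and> c < e \<and> e \<le> n \<and> p e < p c \<and> p c < p b \<and> p b < p a)"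
proof
  assume "contains_pattern n p [4, 3, 2, 1]"
  then obtain s :: "nat \<Rightarrow> nat" where mono: "strict_mono_on {..<4} s" and ran: "s ` {..<4} \<subseteq> {1..n}"
    and ord: "\<And>a b. a < 4 \<Longrightarrow> b < 4 \<Longrightarrow>
      p (s a) < p (s b) \<longleftrightarrow> [4, 3, 2, 1::nat] ! a < [4, 3, 2, 1] ! b"
    unfolding contains_pattern_def by (auto simp: numeral_eq_Suc)
  have "s 0 < s 1" "s 1 < s 2" "s 2 < s 3" using mono by (auto simp: strict_mono_on_def)
  moreover have "1 \<le> s 0" "s 3 \<le> n" using ran by (auto simp: image_subset_iff)
  moreover have "p (s 3) < p (s 2)" "p (s 2) < p (s 1)" "p (s 1) < p (s 0)"
    by (simp_all add: ord)
  ultimately show "\<exists>a b c e. 1 \<le> a \<and> a < b \<and> b < c \<and> c < e \<and> e \<le> n \<and>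
      p e < p c \<and> p c < p b \<and> p b < p a" by blast
next
  assume "\<exists>a b c e. 1 \<le> a \<and> a < b \<and> b < c \<and> c < e \<and> e \<le> n \<and> p e < p c \<and> p c < p b \<and> p b < p a"
  then obtain a b c e where "1 \<le> a" "a < b" "b < c" "c < e" "e \<le> n"
    "p e < p c" "p c < p b" "p b < p a" by blast
  then show "contains_pattern n p [4, 3, 2, 1]"
    unfolding contains_pattern_def
    by (intro exI[of _ "nth [a, b, c, e]"])
      (auto simp: strict_mono_on_def lessThan_Suc All_less_Suc numeral_eq_Suc)
qed

text \<open>Being self-inverse already makes \<open>p\<close> bijective, with \<open>p y\<close> the
  unique preimage of \<open>y\<close>, so \<open>permutes\<close> and \<open>inv\<close> reduce to
  two pointwise equations. The whole condition becomes accessible to linear arithmetic.\<close>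

lemma invols_iff:
  "p \<in> invols_312_4321 n \<longleftrightarrow>
     (\<forall>i. p (p i) = i) \<and> (\<forall>i. i \<notin> {1..n} \<longrightarrow> p i = i) \<and>
     (\<forall>a b c. 1 \<le> a \<and> a < b \<and> b < c \<and> c \<le> n \<longrightarrow> \<not> (p b < p c \<and> p c < p a)) \<and>
     (\<forall>a b c e. 1 \<le> a \<and> a < b \<and> b < c \<and> c < e \<and> e \<le> n \<longrightarrow>
        \<not> (p e < p c \<and> p c < p b \<and> p b < p a))"
proof -
  have "p permutes {1..n} \<and> inv p = p \<longleftrightarrow> (\<forall>i. p (p i) = i) \<and> (\<forall>i. i \<notin> {1..n} \<longrightarrow> p i = i)"
    (is "?L \<longleftrightarrow> ?R")
  proof
    assume ?L
    then show ?R by (metis permutes_inverses(2) permutes_not_in)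
  next
    assume R: ?R
    then have "\<exists>!x. p x = y" for y by (intro ex1I[of _ "p y"]) auto
    then show ?L using R by (simp add: permutes_def inv_equality)
  qed
  then show ?thesis
    unfolding invols_312_4321_def avoids_pattern_def contains_312_iff contains_4321_iff by auto
qed

lemmas invol_inv = invols_iff[THEN iffD1, THEN conjunct1, rule_format]
  and invol_out = invols_iff[THEN iffD1, THEN conjunct2, THEN conjunct1, rule_format]
  and invol_no_312 =
    invols_iff[THEN iffD1, THEN conjunct2, THEN conjunct2, THEN conjunct1, rule_format]
  and invol_no_4321 =
    invols_iff[THEN iffD1, THEN conjunct2, THEN conjunct2, THEN conjunct2, rule_format]

lemma invol_range:
  assumes "p \<in> invols_312_4321 n" "1 \<le> i" "i \<le> n"
  shows "1 \<le> p i" "p i \<le> n"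
proof -
  have "p permutes {1..n}" using assms(1) by (simp add: invols_312_4321_def)
  moreover have "i \<in> {1..n}" using assms(2,3) by simp
  ultimately have "p i \<in> {1..n}" by (metis permutes_in_image)
  then show "1 \<le> p i" "p i \<le> n" by auto
qed

lemma finite_invols: "finite (invols_312_4321 n)"
  by (rule finite_subset[OF _ finite_permutations[of "{1..n}"]])
    (auto simp: invols_312_4321_def)

section \<open>Appending and splitting off a last decreasing block\<close>

definition add_layer :: "nat \<Rightarrow> nat \<Rightarrow> (nat \<Rightarrow> nat) \<Rightarrow> nat \<Rightarrow> nat" where
  "add_layer m k q i = (if m < i \<and> i \<le> m + k then 2 * m + k + 1 - i else q i)"

lemma add_layer_low [simp]: "i \<le> m \<Longrightarrow> add_layer m k q i = q i"
  by (simp add: add_layer_def)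

text \<open>The map \<open>i\<close> to \<open>(m + 1) + (m + k) - i\<close> reverses
  \<open>{m + 1..m + k}\<close>, while positions up to \<open>m\<close> keep values up to
  \<open>m\<close>. In both patterns the last value is below the first, so an occurrence ending in
  the block lies entirely in it; there values decrease, which excludes 312, and at most three
  positions exclude 4321.\<close>

lemma add_layer_in_invols:
  assumes q: "q \<in> invols_312_4321 m" and k: "k \<le> 3"
  shows "add_layer m k q \<in> invols_312_4321 (m + k)"
proof -
  let ?p = "add_layer m k q"
  note inv = invol_inv[OF q] and out = invol_out[OF q]
  have low: "?p i \<le> m" if "i \<le> m" for i
  \<comment> \<open>Position 0 is outside the scope of \<open>invol_range\<close>; it is fixed
    because it is not in \<open>{1..m}\<close>.\<close>
  proof (cases "i = 0")
    case True
    then show ?thesis using out[of 0] by simp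
  next
    case False
    then show ?thesis using that invol_range(2)[OF q, of i] by simp
  qed
  have high: "m < ?p i \<and> ?p i = 2 * m + k + 1 - i" if "m < i" "i \<le> m + k" for i
    using that by (auto simp: add_layer_def)
  show ?thesis
    unfolding invols_iff
  proof (intro conjI allI impI)
    fix i
    show "?p (?p i) = i"
    proof (cases "i \<le> m")
      case True
      then show ?thesis using low[OF True] inv by simp
    next
      case False
      then show ?thesis using out[of i] by (auto simp: add_layer_def)
    qed
  next
    fix i assume "i \<notin> {1..m + k}"
    then show "?p i = i" using out[of i] by (auto simp: add_layer_def)
  next
    fix a b c assume abc: "1 \<le> a \<and> a < b \<and> b < c \<and> c \<le> m + k"
    show "\<not> (?p b < ?p c \<and> ?p c < ?p a)"
    proof (cases "c \<le> m")
      case True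
      then show ?thesis using abc invol_no_312[OF q, of a b c] by simp
    next
      case False
      show ?thesis
      proof
        assume *: "?p b < ?p c \<and> ?p c < ?p a"
        then have "m < a" using False high[of c] low[of a] abc by linarith
        then show False using * high[of b] high[of c] abc by linarith
      qed
    qed
  next
    fix a b c e assume abce: "1 \<le> a \<and> a < b \<and> b < c \<and> c < e \<and> e \<le> m + k"
    show "\<not> (?p e < ?p c \<and> ?p c < ?p b \<and> ?p b < ?p a)"
    proof (cases "e \<le> m")
      case True
      then show ?thesis using abce invol_no_4321[OF q, of a b c e] by simp
    next
      case False
      show ?thesis
      proof
        assume *: "?p e < ?p c \<and> ?p c < ?p b \<and> ?p b < ?p a"
        then have "m < a" using False high[of e] low[of a] abce by linarith
        then show False using abce k by linarith
      qed
    qed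
  qed
qed

text \<open>With \<open>p n = a\<close> and \<open>p a = n\<close>, avoiding 312 confines the values
  at positions strictly between \<open>a\<close> and \<open>n\<close> to that same open interval.
  Two or more such positions would yield a 312 or a 4321, so at most one remains, and it is
  fixed.\<close>

lemma last_layer:
  assumes p: "p \<in> invols_312_4321 n" and n: "1 \<le> n"
  shows "n \<le> p n + 2" and "p n \<le> i \<Longrightarrow> i \<le> n \<Longrightarrow> p i = n + p n - i"
proof -
  define a where "a = p n"
  note inv = invol_inv[OF p]
  have inj: "p i = p j \<longleftrightarrow> i = j" for i j by (metis inv)
  note no312 = invol_no_312[OF p] and no4321 = invol_no_4321[OF p]
  have a: "1 \<le> a" "a \<le> n" and pa: "p a = n" and pn: "p n = a"
    using invol_range[OF p, of n] n inv by (auto simp: a_def)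
  \<comment> \<open>Positions \<open>a\<close>, \<open>i\<close>, \<open>n\<close> carry the values
    \<open>n\<close>, \<open>p i\<close>, \<open>a\<close>, so \<open>p i < a\<close> would be a
    312; injectivity rules out the endpoints.\<close>
  have mid: "a < p i \<and> p i < n" if "a < i" "i < n" for i
    using no312[of a i n] inj[of i n] inj[of i a] invol_range(2)[OF p, of i] that a pa pn
    by linarith
  show *: "n \<le> p n + 2"
  proof (rule ccontr)
    assume "\<not> ?thesis"
    then have less: "a + 2 < n" by (simp add: a_def)
    \<comment> \<open>An ascent here would form a 312 with the value \<open>n\<close> at position
      \<open>a\<close>.\<close>
    have "p (a + 2) < p (a + 1)"
      using no312[of a "a + 1" "a + 2"] inj[of "a + 1" "a + 2"] mid[of "a + 2"] less a pa
      by linarith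
    \<comment> \<open>The descent lies between the value \<open>n\<close> at \<open>a\<close> and
      the value \<open>a\<close> at \<open>n\<close>, which makes a 4321.\<close>
    then show False
      using no4321[of a "a + 1" "a + 2" n] mid[of "a + 1"] mid[of "a + 2"] less a pa pn by linarith
  qed
  show "p i = n + p n - i" if "p n \<le> i" "i \<le> n"
  proof -
    have "i = a \<or> i = n \<or> i = a + 1 \<and> n = a + 2"
      using that * unfolding a_def[symmetric] by presburger
    then show ?thesis
      using mid[of i] pa pn by auto
  qed
qed

lemma invols_remove_last_layer:
  assumes p: "p \<in> invols_312_4321 n" and n: "1 \<le> n"
  obtains k q where "k \<in> {1, 2, 3}" "k \<le> n" "q \<in> invols_312_4321 (n - k)"
    "p = add_layer (n - k) k q"
proof (rule that)
  \<comment> \<open>The last block occupies positions \<open>p n\<close> to \<open>n\<close>, so the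
    part before it has length \<open>m = p n - 1\<close>.\<close>
  define k where "k = n + 1 - p n"
  define m where "m = n - k"
  have pn: "1 \<le> p n" "p n \<le> n" using invol_range[OF p, of n] n by auto
  note le = last_layer(1)[OF p n] and rev = last_layer(2)[OF p n]
  show k: "k \<in> {1, 2, 3}" "k \<le> n" using pn le by (auto simp: k_def)
  have m: "m + 1 = p n" "n = m + k" using pn by (auto simp: m_def k_def)
  note inv = invol_inv[OF p] and out = invol_out[OF p]
  \<comment> \<open>Above \<open>m\<close> the map is reset to the identity, as membership for
    \<open>m\<close> requires.\<close>
  define q where "q = (\<lambda>i. if i \<le> m then p i else i)"
  have low: "p i \<le> m" if "i \<le> m" for i
  proof (rule ccontr)
    assume "\<not> p i \<le> m"
    moreover have "p i \<le> n" using that out[of i] invol_range(2)[OF p, of i] m by fastforce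
    \<comment> \<open>A value \<open>p i\<close> in the block would be reflected back into the
      block, yet \<open>p (p i) = i\<close> is at most \<open>m\<close>.\<close>
    ultimately show False using rev[of "p i"] inv[of i] that m by simp
  qed
  have "q \<in> invols_312_4321 m"
    unfolding invols_iff
  proof (intro conjI allI impI)
    show "q (q i) = i" for i using low inv by (simp add: q_def)
    show "q i = i" if "i \<notin> {1..m}" for i using that out[of i] by (auto simp: q_def)
    show "\<not> (q b < q c \<and> q c < q a)" if "1 \<le> a \<and> a < b \<and> b < c \<and> c \<le> m" for a b c
      using invol_no_312[OF p, of a b c] that m by (auto simp: q_def)
    show "\<not> (q e < q c \<and> q c < q b \<and> q b < q a)"
      if "1 \<le> a \<and> a < b \<and> b < c \<and> c < e \<and> e \<le> m" for a b c e
      using invol_no_4321[OF p, of a b c e] that m by (auto simp: q_def)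
  qed
  then show "q \<in> invols_312_4321 (n - k)" by (simp add: m_def)
  have "p = add_layer m k q"
  proof
    fix i
    show "p i = add_layer m k q i"
      using rev[of i] out[of i] m by (auto simp: add_layer_def q_def)
  qed
  then show "p = add_layer (n - k) k q" by (simp add: m_def)
qed

text \<open>The value at the last position reveals the block length, which separates the images for
  different \<open>k\<close>.\<close>

lemma add_layer_last: "1 \<le> k \<Longrightarrow> add_layer m k q (m + k) = m + 1"
  by (simp add: add_layer_def)

text \<open>Overwriting the block loses no information, since all members for \<open>m\<close> are
  the identity above \<open>m\<close>.\<close>

lemma inj_on_add_layer: "inj_on (add_layer m k) (invols_312_4321 m)"
proof (rule inj_onI, rule ext)
  fix q r i
  assume q: "q \<in> invols_312_4321 m" and r: "r \<in> invols_312_4321 m"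
    and eq: "add_layer m k q = add_layer m k r"
  show "q i = r i"
  proof (cases "i \<le> m")
    case True
    then show ?thesis using fun_cong[OF eq, of i] by simp
  next
    case False
    then show ?thesis using invol_out[OF q, of i] invol_out[OF r, of i] by simp
  qed
qed

text \<open>The guard \<open>k \<le> n\<close> keeps the truncated \<open>n - k\<close> a genuine
  difference, so that no block is longer than the permutation.\<close>

lemma invols_decompose:
  assumes "1 \<le> n"
  shows "invols_312_4321 n =
    (\<Union>k \<in> {k \<in> {1, 2, 3}. k \<le> n}. add_layer (n - k) k ` invols_312_4321 (n - k))"
proof (intro equalityI subsetI)
  fix p assume "p \<in> invols_312_4321 n"
  from invols_remove_last_layer[OF this assms]
  show "p \<in> (\<Union>k \<in> {k \<in> {1, 2, 3}. k \<le> n}. add_layer (n - k) k ` invols_312_4321 (n - k))"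
    by (metis (mono_tags, lifting) UN_iff image_eqI mem_Collect_eq)
next
  fix p assume "p \<in> (\<Union>k \<in> {k \<in> {1, 2, 3}. k \<le> n}. add_layer (n - k) k ` invols_312_4321 (n - k))"
  then obtain k q where "k \<in> {1, 2, 3}" "k \<le> n" "q \<in> invols_312_4321 (n - k)"
    "p = add_layer (n - k) k q" by blast
  then show "p \<in> invols_312_4321 n"
    using add_layer_in_invols[of q "n - k" k] by auto
qed

section \<open>The four statistics under appending a block\<close>

lemma orbit_involution:
  assumes inv: "p (p i) = i"
  shows "orbit p i = {i, p i}"
proof
  show "orbit p i \<subseteq> {i, p i}"
  proof
    fix j assume "j \<in> orbit p i"
    then show "j \<in> {i, p i}" by induction (auto simp: inv)
  qed
  show "{i, p i} \<subseteq> orbit p i"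
    using orbit.base[of p i] orbit.step[of "p i" p i] by (simp add: inv)
qed

text \<open>In this form the cycle count can be split between the positions up to \<open>m\<close>
  and the new block.\<close>

lemma cyc_invol:
  assumes "p \<in> invols_312_4321 n"
  shows "cyc n p = card ((\<lambda>i. {i, p i}) ` {1..n})"
proof -
  have "orbit p i = {i, p i}" for i by (simp add: invol_inv[OF assms] orbit_involution)
  then show ?thesis by (simp add: cyc_def)
qed

lemma atLeastAtMost_split: "{1..m + k} = {1..m} \<union> {m + 1..m + (k::nat)}"
  by auto

text \<open>The reversal fixes \<open>i\<close> exactly when \<open>i\<close> is the centre of the
  block, which is what \<open>2 * i = 2 * m + k + 1\<close> says.\<close>

lemma fp_add_layer:
  "fp (m + k) (add_layer m k q) = fp m q + card {i \<in> {m + 1..m + k}. 2 * i = 2 * m + k + 1}"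
proof -
  have "{i \<in> {1..m + k}. add_layer m k q i = i} =
      {i \<in> {1..m}. q i = i} \<union> {i \<in> {m + 1..m + k}. 2 * i = 2 * m + k + 1}"
    unfolding atLeastAtMost_split by (auto simp: add_layer_def)
  then show ?thesis unfolding fp_def by (subst card_Un_disjoint[symmetric]) auto
qed

text \<open>The reversal moves up exactly the positions left of the centre.\<close>

lemma exc_add_layer:
  "exc (m + k) (add_layer m k q) = exc m q + card {i \<in> {m + 1..m + k}. 2 * i < 2 * m + k + 1}"
proof -
  have "{i \<in> {1..m + k}. add_layer m k q i > i} =
      {i \<in> {1..m}. q i > i} \<union> {i \<in> {m + 1..m + k}. 2 * i < 2 * m + k + 1}"
    unfolding atLeastAtMost_split by (auto simp: add_layer_def)
  then show ?thesis unfolding exc_def by (subst card_Un_disjoint[symmetric]) auto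
qed

text \<open>The block lies to the right of and above all of \<open>q\<close>, so no inversion
  crosses, and inside the block every pair is inverted.\<close>

lemma inversion_count_add_layer:
  assumes q: "q \<in> invols_312_4321 m"
  shows "inversion_count (m + k) (add_layer m k q) =
    inversion_count m q + card {(i, j). i \<in> {m + 1..m + k} \<and> j \<in> {m + 1..m + k} \<and> i < j}"
proof -
  have low: "q i \<le> m" if "1 \<le> i" "i \<le> m" for i
    using invol_range(2)[OF q] that by auto
  have "i \<in> {1..m + k} \<and> j \<in> {1..m + k} \<and> i < j \<and> add_layer m k q i > add_layer m k q j \<longleftrightarrow>
      (i \<in> {1..m} \<and> j \<in> {1..m} \<and> i < j \<and> q i > q j) \<or>
      (i \<in> {m + 1..m + k} \<and> j \<in> {m + 1..m + k} \<and> i < j)" for i j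
  proof -
    consider "j \<le> m" | "i \<le> m" "m < j" | "m < i" by linarith
    then show ?thesis
    proof cases
      case 1
      then show ?thesis by auto
    next
      case 2
      then show ?thesis using low[of i] by (auto simp: add_layer_def)
    next
      case 3
      then show ?thesis by (auto simp: add_layer_def)
    qed
  qed
  then have split: "{(i, j). i \<in> {1..m + k} \<and> j \<in> {1..m + k} \<and> i < j \<and>
        add_layer m k q i > add_layer m k q j} =
      {(i, j). i \<in> {1..m} \<and> j \<in> {1..m} \<and> i < j \<and> q i > q j} \<union>
      {(i, j). i \<in> {m + 1..m + k} \<and> j \<in> {m + 1..m + k} \<and> i < j}" (is "_ = ?A \<union> ?B")
    by blast
  have "finite ?A"
    by (rule finite_subset[of _ "{1..m} \<times> {1..m}"]) auto
  moreover have "finite ?B"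
    by (rule finite_subset[of _ "{m + 1..m + k} \<times> {m + 1..m + k}"]) auto
  moreover have "?A \<inter> ?B = {}" by auto
  ultimately show ?thesis
    unfolding inversion_count_def split by (rule card_Un_disjoint)
qed

text \<open>No cycle meets both \<open>{1..m}\<close> and the block. The bound on \<open>k\<close>
  puts the enlarged permutation in the class, so that \<open>cyc_invol\<close> applies to
  it.\<close>

lemma cyc_add_layer:
  assumes q: "q \<in> invols_312_4321 m" and k: "k \<le> 3"
  shows "cyc (m + k) (add_layer m k q) =
    cyc m q + card ((\<lambda>i. {i, 2 * m + k + 1 - i}) ` {m + 1..m + k})"
proof -
  have low: "q i \<le> m" if "1 \<le> i" "i \<le> m" for i
    using invol_range(2)[OF q] that by auto
  have "(\<lambda>i. {i, add_layer m k q i}) ` {1..m + k} =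
      (\<lambda>i. {i, q i}) ` {1..m} \<union> (\<lambda>i. {i, 2 * m + k + 1 - i}) ` {m + 1..m + k}"
    unfolding atLeastAtMost_split image_Un
    by (intro arg_cong2[of _ _ _ _ "(\<union>)"] image_cong) (auto simp: add_layer_def)
  moreover have "(\<lambda>i. {i, q i}) ` {1..m} \<inter> (\<lambda>i. {i, 2 * m + k + 1 - i}) ` {m + 1..m + k} = {}"
    using low by (fastforce simp: doubleton_eq_iff)
  ultimately show ?thesis
    unfolding cyc_invol[OF q] cyc_invol[OF add_layer_in_invols[OF q k]]
    by (simp add: card_Un_disjoint)
qed

section \<open>Weights and their linear recurrence\<close>

definition weight :: "nat \<Rightarrow> (nat \<Rightarrow> nat) \<Rightarrow> coeff_ring" where
  "weight n p = var_t ^ cyc n p * var_u ^ fp n p * var_x ^ exc n p * var_y ^ inversion_count n p"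

text \<open>Size 1 is a fixed point and size 2 a transposition with one excedance and one inversion.
  Size 3 exchanges its ends and fixes its centre: two cycles, one excedance, three
  inversions.\<close>

definition layer_weight :: "nat \<Rightarrow> coeff_ring" where
  "layer_weight k =
     (if k = 1 then var_t * var_u
      else if k = 2 then var_t * var_x * var_y
      else var_t ^ 2 * var_u * var_x * var_y ^ 3)"

lemma weight_add_layer:
  assumes q: "q \<in> invols_312_4321 m" and k: "k \<in> {1, 2, 3}"
  shows "weight (m + k) (add_layer m k q) = layer_weight k * weight m q"
proof -
  have I: "{m + 1..m + 1} = {m + 1}" "{m + 1..m + 2} = {m + 1, m + 2}"
    "{m + 1..m + 3} = {m + 1, m + 2, m + 3}" by auto
  have "{i \<in> {m + 1..m + 1}. 2 * i = 2 * m + 1 + 1} = {m + 1}"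
    "{i \<in> {m + 1..m + 2}. 2 * i = 2 * m + 2 + 1} = {}"
    "{i \<in> {m + 1..m + 3}. 2 * i = 2 * m + 3 + 1} = {m + 2}" by (auto, presburger)
  then have fp: "fp (m + 1) (add_layer m 1 q) = fp m q + 1"
    "fp (m + 2) (add_layer m 2 q) = fp m q"
    "fp (m + 3) (add_layer m 3 q) = fp m q + 1"
    unfolding fp_add_layer by simp_all
  have "{i \<in> {m + 1..m + 1}. 2 * i < 2 * m + 1 + 1} = {}"
    "{i \<in> {m + 1..m + 2}. 2 * i < 2 * m + 2 + 1} = {m + 1}"
    "{i \<in> {m + 1..m + 3}. 2 * i < 2 * m + 3 + 1} = {m + 1}" by auto
  then have exc: "exc (m + 1) (add_layer m 1 q) = exc m q"
    "exc (m + 2) (add_layer m 2 q) = exc m q + 1"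
    "exc (m + 3) (add_layer m 3 q) = exc m q + 1"
    unfolding exc_add_layer by simp_all
  have pairs: "{(i, j). i \<in> {m + 1..m + 1} \<and> j \<in> {m + 1..m + 1} \<and> i < j} = {}"
    "{(i, j). i \<in> {m + 1..m + 2} \<and> j \<in> {m + 1..m + 2} \<and> i < j} = {(m + 1, m + 2)}"
    "{(i, j). i \<in> {m + 1..m + 3} \<and> j \<in> {m + 1..m + 3} \<and> i < j} =
      {(m + 1, m + 2), (m + 1, m + 3), (m + 2, m + 3)}" by auto
  have invs: "inversion_count (m + 1) (add_layer m 1 q) = inversion_count m q"
    "inversion_count (m + 2) (add_layer m 2 q) = inversion_count m q + 1"
    "inversion_count (m + 3) (add_layer m 3 q) = inversion_count m q + 3"
    unfolding inversion_count_add_layer[OF q] pairs by simp_all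
  have cycles: "(\<lambda>i. {i, 2 * m + 1 + 1 - i}) ` {m + 1..m + 1} = {{m + 1}}"
    "(\<lambda>i. {i, 2 * m + 2 + 1 - i}) ` {m + 1..m + 2} = {{m + 1, m + 2}}"
    "(\<lambda>i. {i, 2 * m + 3 + 1 - i}) ` {m + 1..m + 3} = {{m + 1, m + 3}, {m + 2}}"
    unfolding I by auto
  have le3: "(1::nat) \<le> 3" "(2::nat) \<le> 3" "(3::nat) \<le> 3" by simp_all
  have cyc: "cyc (m + 1) (add_layer m 1 q) = cyc m q + 1"
    "cyc (m + 2) (add_layer m 2 q) = cyc m q + 1"
    "cyc (m + 3) (add_layer m 3 q) = cyc m q + 2"
    unfolding le3[THEN cyc_add_layer[OF q]] cycles by (simp_all add: doubleton_eq_iff)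
  have "weight (m + 1) (add_layer m 1 q) = layer_weight 1 * weight m q"
    "weight (m + 2) (add_layer m 2 q) = layer_weight 2 * weight m q"
    "weight (m + 3) (add_layer m 3 q) = layer_weight 3 * weight m q"
    unfolding weight_def fp exc invs cyc layer_weight_def
    by (simp_all add: power_add power2_eq_square mult_ac)
  then show ?thesis using k by blast
qed

definition total_weight :: "nat \<Rightarrow> coeff_ring" where
  "total_weight n = (\<Sum>p\<in>invols_312_4321 n. weight n p)"

text \<open>The sum is split by the length of the last block. The shape
  \<open>if n < k then 0\<close> is that of the coefficients of a product with
  \<open>fps_X ^ k\<close>.\<close>

lemma total_weight_rec:
  assumes "1 \<le> n"
  shows "total_weight n =
    (\<Sum>k\<in>{1, 2, 3}. if n < k then 0 else layer_weight k * total_weight (n - k))"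
proof -
  let ?K = "{k \<in> {1, 2, 3}. k \<le> n}"
  let ?I = "\<lambda>k. add_layer (n - k) k ` invols_312_4321 (n - k)"
  have disj: "?I k \<inter> ?I l = {}" if "k \<in> ?K" "l \<in> ?K" "k \<noteq> l" for k l
  proof -
    \<comment> \<open>The value at \<open>n\<close> determines \<open>n - k\<close>, hence
      \<open>k\<close> because \<open>k \<le> n\<close>.\<close>
    have "p n = n - k + 1" if "k \<in> ?K" "p \<in> ?I k" for k p
      using that add_layer_last[of k "n - k"] by auto
    then have "n - k = n - l" if "p \<in> ?I k" "p \<in> ?I l" for p
      using that \<open>k \<in> ?K\<close> \<open>l \<in> ?K\<close> by (metis add_right_imp_eq)
    moreover have "n - k \<noteq> n - l" using that by auto
    ultimately show ?thesis by blast
  qed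
  have "total_weight n = (\<Sum>k\<in>?K. \<Sum>p\<in>?I k. weight n p)"
    unfolding total_weight_def invols_decompose[OF assms]
    by (rule sum.UNION_disjoint) (auto simp: finite_invols disj)
  also have "\<dots> = (\<Sum>k\<in>?K. layer_weight k * total_weight (n - k))"
  proof (rule sum.cong[OF refl])
    fix k assume k: "k \<in> ?K"
    have "weight n (add_layer (n - k) k q) = layer_weight k * weight (n - k) q"
      if "q \<in> invols_312_4321 (n - k)" for q
      using k weight_add_layer[OF that, of k] by simp
    then show "(\<Sum>p\<in>?I k. weight n p) = layer_weight k * total_weight (n - k)"
      by (simp add: sum.reindex[OF inj_on_add_layer] total_weight_def sum_distrib_left)
  qed
  also have "\<dots> = (\<Sum>k\<in>{1, 2, 3}. if k \<le> n then layer_weight k * total_weight (n - k) else 0)"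
    by (rule sum.inter_filter) simp
  finally show ?thesis by (simp add: not_less[symmetric] if_distrib cong: if_cong)
qed

text \<open>The empty permutation, which is \<open>id\<close> as a function on all naturals, starts
  the recurrence and supplies the 1 in \<open>1 + D\<close>.\<close>

lemma total_weight_0: "total_weight 0 = 1"
proof -
  have "invols_312_4321 0 = {id}" by (auto simp: invols_iff)
  then show ?thesis
    by (simp add: total_weight_def weight_def cyc_def fp_def exc_def inversion_count_def)
qed

section \<open>From total weights to the power series\<close>

lemma Sum_any_statistics:
  "Sum_any (\<lambda>(k, l, m, j).
     of_nat (d n k l m j) * var_t ^ k * var_u ^ m * var_x ^ l * var_y ^ j) = total_weight n"
proof -
  let ?g = "\<lambda>p. (cyc n p, exc n p, fp n p, inversion_count n p)"
  let ?w = "\<lambda>(k, l, m, j). var_t ^ k * var_u ^ m * var_x ^ l * var_y ^ j"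
  let ?f = "\<lambda>y. of_nat (card {p \<in> invols_312_4321 n. ?g p = y}) * ?w y"
  have "(\<lambda>(k, l, m, j). of_nat (d n k l m j) * var_t ^ k * var_u ^ m * var_x ^ l * var_y ^ j) = ?f"
    by (auto simp: fun_eq_iff d_def mult.assoc 
        intro!: arg_cong[of _ _ card] arg_cong2[of _ _ _ _ "(*)"] arg_cong[of _ _ of_nat])
  \<comment> \<open>The support is finite, so \<open>Sum_any\<close> is an actual sum and not its
    default value 0.\<close>
  moreover have "{y. ?f y \<noteq> 0} \<subseteq> ?g ` invols_312_4321 n"
  proof
    fix y assume "y \<in> {y. ?f y \<noteq> 0}"
    then have "{p \<in> invols_312_4321 n. ?g p = y} \<noteq> {}"
      by (metis (mono_tags, lifting) card.empty mem_Collect_eq mult_zero_left of_nat_0)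
    then show "y \<in> ?g ` invols_312_4321 n" by blast
  qed
  ultimately have "Sum_any (\<lambda>(k, l, m, j).
      of_nat (d n k l m j) * var_t ^ k * var_u ^ m * var_x ^ l * var_y ^ j) =
      (\<Sum>y\<in>?g ` invols_312_4321 n. ?f y)"
    using Sum_any.expand_superset[of "?g ` invols_312_4321 n" ?f] finite_invols[of n] by simp
  \<comment> \<open>Grouping the permutations by their statistics is undone: each fibre of
    \<open>?g\<close> contributes its cardinality times a common monomial.\<close>
  also have "\<dots> = (\<Sum>p\<in>invols_312_4321 n. ?w (?g p))"
    by (rule sum_fun_comp[symmetric]) (auto simp: finite_invols)
  finally show ?thesis by (simp add: total_weight_def weight_def)
qed

text \<open>Cancelling \<open>g\<close> against its right inverse reduces the claim about a quotient
  to a product identity.\<close>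

lemma fps_quot_eqI:
  fixes f g h :: "'a::comm_ring_1 fps"
  assumes "fps_nth g 0 = 1" "h * g = f"
  shows "h = fps_quot f g"
proof -
  have "g * fps_right_inverse g 1 = 1"
    by (rule fps_right_inverse) (simp add: assms(1))
  then show ?thesis
    unfolding fps_quot_def assms(2)[symmetric] by (simp add: mult.assoc)
qed

theorem theorem11:
  shows "D =
    fps_quot
      (fps_const (var_t * var_u) * fps_X
        + fps_const (var_t * var_x * var_y) * fps_X ^ 2
        + fps_const (var_t ^ 2 * var_u * var_x * var_y ^ 3) * fps_X ^ 3)
      (1 - fps_const (var_u * var_t) * fps_X
        - fps_const (var_t * var_x * var_y) * fps_X ^ 2
        - fps_const (var_t ^ 2 * var_u * var_x * var_y ^ 3) * fps_X ^ 3)"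
proof (rule fps_quot_eqI)
  let ?P = "fps_const (var_t * var_u) * fps_X
        + fps_const (var_t * var_x * var_y) * fps_X ^ 2
        + fps_const (var_t ^ 2 * var_u * var_x * var_y ^ 3) * fps_X ^ 3"
  have P: "?P = (\<Sum>k\<in>{1, 2, 3}. fps_const (layer_weight k) * fps_X ^ k)"
    by (simp add: layer_weight_def add.assoc)
  \<comment> \<open>\<open>D\<close> has constant term 0, so adding 1 inserts exactly the total
    weight of size 0.\<close>
  have E: "1 + D = Abs_fps total_weight"
    by (rule fps_ext) (auto simp: D_def Sum_any_statistics total_weight_0 Suc_le_eq)
  have "fps_nth (?P * Abs_fps total_weight) n =
      (\<Sum>k\<in>{1, 2, 3}. if n < k then 0 else layer_weight k * total_weight (n - k))" for n
    unfolding P sum_distrib_right fps_sum_nth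
    by (intro sum.cong refl) (simp add: mult.assoc fps_X_power_mult_nth)
  then have "Abs_fps total_weight = 1 + ?P * Abs_fps total_weight"
    by (intro fps_ext) (auto simp: total_weight_0 total_weight_rec Suc_le_eq)
  then have "1 + D = 1 + ?P * (1 + D)" by (simp only: E)
  \<comment> \<open>With \<open>P\<close> for the numerator, \<open>1 + D = 1 + P * (1 + D)\<close>
    rearranges to \<open>D * (1 - P) = P\<close>.\<close>
  then show "D * (1 - fps_const (var_u * var_t) * fps_X
        - fps_const (var_t * var_x * var_y) * fps_X ^ 2
        - fps_const (var_t ^ 2 * var_u * var_x * var_y ^ 3) * fps_X ^ 3) = ?P"
    by (simp add: algebra_simps)
qed simp

end
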